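(* Let $K=\{l_1,l_2,\ldots,l_k\}$ be a set of $k$ positive integers, and let $m,d$ be positive integers. There exists a cross $K$-intersection family with $m$ blocks on a set of $d$ points if and only if there exists a biclique cover of type $K$ and size $d$ of $K_{m,m}^-$.
   Context: All graphs are finite and simple. $K_{m,m}^-$ denotes the complete bipartite graph $K_{m,m}$ with (the edges of) a perfect matching removed. A biclique of a graph $G$ is a complete bipartite subgraph of $G$; it is given by two disjoint vertex classes $X,Y\subseteq V(G)$ such that every vertex of $X$ is adjacent in $G$ to every vertex of $Y$, its edges being all pairs $xy$ with $x\in X$, $y\in Y$ (a class may be empty). A biclique cover of $G$ is a collection (indexed family, repetitions allowed) of bicliques of $G$ such that every edge of $G$ belongs to at least one of them; the number of bicliques in the collection is its size. For a set $K$ of positive integers, a biclique cover of $G$ is of type $K$ if for every edge $e$ of $G$ the number of bicliques of the cover that contain $e$ is an element of $K$. A cross $K$-intersection family with $m$ blocks on a set $X$ of $d$ points is a pair $(\mathcal{A},\mathcal{B})$ of indexed collections $\mathcal{A}=\{A_1,\ldots,A_m\}$ and $\mathcal{B}=\{B_1,\ldots,B_m\}$ of subsets of $X$ such that $|A_i\cap B_j|\in K$ for all $i\ne j$ and $|A_i\cap B_i|=0$ for every $i$. *)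

theory Defs
  imports Main "HOL-Library.Infinite_Typeclass"
begin

text \<open>A graph is given by its vertex set and its set of edges, the edges being unordered pairs.\<close>

type_synonym 'v graph = "'v set \<times> 'v set set"

abbreviation verts :: "'v graph \<Rightarrow> 'v set" where
  "verts \<equiv> fst"

abbreviation edges :: "'v graph \<Rightarrow> 'v set set" where
  "edges \<equiv> snd"

definition simple_graph :: "'v graph \<Rightarrow> bool" where
  "simple_graph G \<longleftrightarrow> finite (verts G) \<and> (\<forall>e\<in>edges G. e \<subseteq> verts G \<and> card e = 2)"

definition complete_bipartite :: "nat \<Rightarrow> nat \<Rightarrow> (nat + nat) graph" where
  "complete_bipartite m n =
     (Inl ` {..<m} \<union> Inr ` {..<n}, {{Inl i, Inr j} | i j. i < m \<and> j < n})"

definition delete_edges :: "'v graph \<Rightarrow> 'v set set \<Rightarrow> 'v graph" where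
  "delete_edges G F = (verts G, edges G - F)"

text \<open>All perfect matchings of the complete bipartite graph are equivalent under its automorphisms;
  the one removed here joins equally indexed vertices of the two sides.\<close>

definition crown_graph :: "nat \<Rightarrow> (nat + nat) graph" where
  "crown_graph m = delete_edges (complete_bipartite m m) {{Inl i, Inr i} | i. i < m}"

lemma simple_graph_crown_graph: "simple_graph (crown_graph m)"
  by (auto simp: simple_graph_def crown_graph_def delete_edges_def complete_bipartite_def)

text \<open>A biclique is represented by its pair of vertex classes, either of which may be empty.\<close>

definition biclique :: "'v graph \<Rightarrow> 'v set \<times> 'v set \<Rightarrow> bool" where
  "biclique G Q \<longleftrightarrow> (case Q of (X, Y) \<Rightarrow>
     X \<subseteq> verts G \<and> Y \<subseteq> verts G \<and> X \<inter> Y = {} \<and> (\<forall>x\<in>X. \<forall>y\<in>Y. {x, y} \<in> edges G))"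

definition biclique_edges :: "'v set \<times> 'v set \<Rightarrow> 'v set set" where
  "biclique_edges Q = (case Q of (X, Y) \<Rightarrow> {{x, y} | x y. x \<in> X \<and> y \<in> Y})"

text \<open>A cover of size \<open>d\<close> is a family indexed by \<open>{..<d}\<close>, so bicliques may be repeated
  and repetitions count.\<close>

definition biclique_cover :: "'v graph \<Rightarrow> nat \<Rightarrow> (nat \<Rightarrow> 'v set \<times> 'v set) \<Rightarrow> bool" where
  "biclique_cover G d C \<longleftrightarrow>
     (\<forall>t<d. biclique G (C t)) \<and> (\<forall>e\<in>edges G. \<exists>t<d. e \<in> biclique_edges (C t))"

definition biclique_cover_of_type ::
    "nat set \<Rightarrow> 'v graph \<Rightarrow> nat \<Rightarrow> (nat \<Rightarrow> 'v set \<times> 'v set) \<Rightarrow> bool" where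
  "biclique_cover_of_type K G d C \<longleftrightarrow>
     biclique_cover G d C \<and> (\<forall>e\<in>edges G. card {t. t < d \<and> e \<in> biclique_edges (C t)} \<in> K)"

text \<open>The blocks are indexed by \<open>{..<m}\<close>; the values of \<open>A\<close> and \<open>B\<close> elsewhere are irrelevant.\<close>

definition cross_intersection_family ::
    "nat set \<Rightarrow> nat \<Rightarrow> 'p set \<Rightarrow> (nat \<Rightarrow> 'p set) \<Rightarrow> (nat \<Rightarrow> 'p set) \<Rightarrow> bool" where
  "cross_intersection_family K m X A B \<longleftrightarrow>
     finite X \<and>
     (\<forall>i<m. A i \<subseteq> X \<and> B i \<subseteq> X) \<and>
     (\<forall>i<m. \<forall>j<m. i \<noteq> j \<longrightarrow> card (A i \<inter> B j) \<in> K) \<and>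
     (\<forall>i<m. card (A i \<inter> B i) = 0)"

end

theory Submission
  imports Defs
begin

text \<open>Let \<open>A\<close> and \<open>B\<close> be the two families of blocks, and let the points index the bicliques. The
  incidence structure is then read in two ways: a point \<open>p\<close> belongs to the block \<open>A i\<close> (or \<open>B j\<close>)
  exactly when the biclique of \<open>p\<close> uses the left vertex \<open>i\<close> (or the right vertex \<open>j\<close>) of the crown
  graph. Under this dictionary \<open>A i \<inter> B j\<close> is the set of bicliques containing the edge from \<open>i\<close> to
  \<open>j\<close>, so for \<open>i \<noteq> j\<close> its size is the multiplicity with which that edge is covered, while
  \<open>A i \<inter> B i = {}\<close> says that no biclique contains an edge of the removed matching. Since all
  members of \<open>K\<close> are positive, multiplicities in \<open>K\<close> already force every edge to be covered.

  From blocks to bicliques the dictionary is immediate. In the other direction the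
  classes of a biclique are not told apart: either class may lie on the left, and if one class is
  empty the other may even meet both sides. Speaking of the vertices that lie on an edge of the
  biclique, rather than of its classes, removes both ambiguities; this is the content of
  \<open>biclique_edge_iff_covers_ends\<close>.\<close>

lemma edge_crown_graph_iff:
  "{Inl i, Inr j} \<in> edges (crown_graph m) \<longleftrightarrow> i < m \<and> j < m \<and> i \<noteq> j"
  by (simp add: crown_graph_def delete_edges_def complete_bipartite_def doubleton_eq_iff) blast

lemma edges_crown_graph:
  "edges (crown_graph m) = {{Inl i, Inr j} | i j. i < m \<and> j < m \<and> i \<noteq> j}"
  (is "?E = ?D")
proof
  show "?E \<subseteq> ?D"
    by (simp add: crown_graph_def delete_edges_def complete_bipartite_def) blast
  show "?D \<subseteq> ?E"
    by (clarsimp simp: edge_crown_graph_iff)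
qed

lemma verts_crown_graph: "verts (crown_graph m) = Inl ` {..<m} \<union> Inr ` {..<m}"
  by (simp add: crown_graph_def delete_edges_def complete_bipartite_def)

lemma Inl_Inl_not_edge_crown_graph: "{Inl i, Inl j} \<notin> edges (crown_graph m)"
  and Inr_Inr_not_edge_crown_graph: "{Inr i, Inr j} \<notin> edges (crown_graph m)"
  by (simp_all add: edges_crown_graph doubleton_eq_iff)

lemma biclique_edges_subset: "biclique G Q \<Longrightarrow> biclique_edges Q \<subseteq> edges G"
  by (auto simp: biclique_def biclique_edges_def)

lemma biclique_cover_of_type_iff:
  assumes "\<forall>l\<in>K. 0 < l"
  shows "biclique_cover_of_type K G d C \<longleftrightarrow>
    (\<forall>t<d. biclique G (C t)) \<and>
    (\<forall>e\<in>edges G. card {t. t < d \<and> e \<in> biclique_edges (C t)} \<in> K)"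
proof -
  have "\<exists>t<d. e \<in> biclique_edges (C t)"
    if "card {t. t < d \<and> e \<in> biclique_edges (C t)} \<in> K" for e
  proof -
    have "0 < card {t. t < d \<and> e \<in> biclique_edges (C t)}"
      using assms that by blast
    then show ?thesis
      by (auto simp: card_gt_0_iff)
  qed
  then show ?thesis
    unfolding biclique_cover_of_type_def biclique_cover_def by blast
qed

text \<open>If a left and a right vertex both lie on edges of a biclique, they lie in opposite classes:
  in a common class they would share a neighbour, which is impossible in a bipartite graph.\<close>

lemma biclique_edge_iff_covers_ends:
  assumes "biclique (crown_graph m) Q"
  shows "{Inl i, Inr j} \<in> biclique_edges Q \<longleftrightarrow>
    Inl i \<in> \<Union> (biclique_edges Q) \<and> Inr j \<in> \<Union> (biclique_edges Q)"
proof
  assume "{Inl i, Inr j} \<in> biclique_edges Q"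
  then show "Inl i \<in> \<Union> (biclique_edges Q) \<and> Inr j \<in> \<Union> (biclique_edges Q)"
    by blast
next
  assume ends: "Inl i \<in> \<Union> (biclique_edges Q) \<and> Inr j \<in> \<Union> (biclique_edges Q)"
  obtain X Y where Q: "Q = (X, Y)"
    by (cases Q)
  have adj: "{x, y} \<in> edges (crown_graph m)" "{y, x} \<in> edges (crown_graph m)"
    if "x \<in> X" "y \<in> Y" for x y
    using assms that unfolding Q biclique_def by (simp_all add: insert_commute[of y])
  have no_common_neighbour:
    "\<not> ({Inl i, v} \<in> edges (crown_graph m) \<and> {Inr j, v} \<in> edges (crown_graph m))" for v
    by (cases v) (simp_all add: Inl_Inl_not_edge_crown_graph Inr_Inr_not_edge_crown_graph)
  have classes: "Inl i \<in> X \<union> Y" "Inr j \<in> X \<union> Y" and nonempty: "X \<noteq> {}" "Y \<noteq> {}"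
    using ends unfolding Q biclique_edges_def by blast+
  have "\<not> (Inl i \<in> X \<and> Inr j \<in> X)"
  proof
    assume X: "Inl i \<in> X \<and> Inr j \<in> X"
    obtain v where "v \<in> Y"
      using nonempty by blast
    then show False
      using X adj(1)[of _ v] no_common_neighbour[of v] by simp
  qed
  moreover have "\<not> (Inl i \<in> Y \<and> Inr j \<in> Y)"
  proof
    assume Y: "Inl i \<in> Y \<and> Inr j \<in> Y"
    obtain v where "v \<in> X"
      using nonempty by blast
    then show False
      using Y adj(2)[of v] no_common_neighbour[of v] by simp
  qed
  ultimately consider "Inl i \<in> X" "Inr j \<in> Y" | "Inr j \<in> X" "Inl i \<in> Y"
    using classes by blast
  then show "{Inl i, Inr j} \<in> biclique_edges Q"
    unfolding Q biclique_edges_def by cases auto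
qed

lemma biclique_cover_if_cross_intersection_family:
  assumes pos: "\<forall>l\<in>K. 0 < l"
    and h: "bij_betw h {..<d} X"
    and family: "cross_intersection_family K m X A B"
  shows "biclique_cover_of_type K (crown_graph m) d
    (\<lambda>t. (Inl ` {i. i < m \<and> h t \<in> A i}, Inr ` {j. j < m \<and> h t \<in> B j}))"
    (is "biclique_cover_of_type _ _ _ ?C")
proof -
  have sub: "A i \<subseteq> X" "B i \<subseteq> X" if "i < m" for i
    using family that by (auto simp: cross_intersection_family_def)
  have disj: "A i \<inter> B i = {}" if "i < m" for i
  proof -
    have "finite (A i \<inter> B i)" "card (A i \<inter> B i) = 0"
      using family that by (auto simp: cross_intersection_family_def intro: finite_subset)
    then show ?thesis
      by simp
  qed
  have "biclique (crown_graph m) (?C t)" for t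
    unfolding biclique_def
    using disj
    by (fastforce simp: edge_crown_graph_iff verts_crown_graph)
  moreover have "card {t. t < d \<and> e \<in> biclique_edges (?C t)} \<in> K"
    if edge: "e \<in> edges (crown_graph m)" for e
  proof -
    obtain i j where e: "e = {Inl i, Inr j}" and ij: "i < m" "j < m" "i \<noteq> j"
      using edge unfolding edges_crown_graph by blast
    have "{t. t < d \<and> e \<in> biclique_edges (?C t)} = {t \<in> {..<d}. h t \<in> A i \<inter> B j}"
      using ij by (auto simp: e biclique_edges_def doubleton_eq_iff)
    moreover have "bij_betw h {t \<in> {..<d}. h t \<in> A i \<inter> B j} (A i \<inter> B j)"
      using h sub(1)[OF ij(1)] unfolding bij_betw_def inj_on_def by auto
    ultimately show ?thesis
      using family ij
      by (auto simp: cross_intersection_family_def dest: bij_betw_same_card)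
  qed
  ultimately show ?thesis
    using biclique_cover_of_type_iff[OF pos] by blast
qed

lemma cross_intersection_family_if_biclique_cover:
  assumes h: "bij_betw h {..<d} X"
    and cover: "biclique_cover_of_type K (crown_graph m) d C"
  shows "cross_intersection_family K m X
    (\<lambda>i. h ` {t. t < d \<and> Inl i \<in> \<Union> (biclique_edges (C t))})
    (\<lambda>j. h ` {t. t < d \<and> Inr j \<in> \<Union> (biclique_edges (C t))})"
proof -
  define S where "S i = {t. t < d \<and> Inl i \<in> \<Union> (biclique_edges (C t))}" for i
  define T where "T j = {t. t < d \<and> Inr j \<in> \<Union> (biclique_edges (C t))}" for j
  have inj: "inj_on h {..<d}" and img: "h ` {..<d} = X"
    using h by (auto simp: bij_betw_def)
  have sub: "S i \<subseteq> {..<d}" "T j \<subseteq> {..<d}" for i j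
    by (auto simp only: S_def T_def lessThan_iff)
  have bic: "biclique (crown_graph m) (C t)" if "t < d" for t
    using cover that by (auto simp: biclique_cover_of_type_def biclique_cover_def)
  have inter: "S i \<inter> T j = {t. t < d \<and> {Inl i, Inr j} \<in> biclique_edges (C t)}" for i j
    unfolding S_def T_def
    using biclique_edge_iff_covers_ends[OF bic, of _ i j]
    by (intro set_eqI) (simp only: Int_iff mem_Collect_eq, metis)
  have card_inter: "card (h ` S i \<inter> h ` T j) = card (S i \<inter> T j)" for i j
  proof -
    have "h ` S i \<inter> h ` T j = h ` (S i \<inter> T j)"
      by (rule inj_on_image_Int[OF inj sub, symmetric])
    moreover have "inj_on h (S i \<inter> T j)"
      using inj_on_subset[OF inj] sub(1) by (meson inf.coboundedI1)
    ultimately show ?thesis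
      by (simp add: card_image)
  qed
  have "card (S i \<inter> T j) \<in> K" if "i < m" "j < m" "i \<noteq> j" for i j
    using cover that
    unfolding inter biclique_cover_of_type_def by (simp add: edge_crown_graph_iff)
  moreover have "S i \<inter> T i = {}" for i
  proof -
    have "{Inl i, Inr i} \<notin> biclique_edges (C t)" if "t < d" for t
      using biclique_edges_subset[OF bic[OF that]] edge_crown_graph_iff[of i i m] by blast
    then show ?thesis
      unfolding inter by blast
  qed
  moreover have "finite X"
    unfolding img[symmetric] by simp
  moreover have "h ` S i \<subseteq> X" "h ` T i \<subseteq> X" for i
    unfolding img[symmetric] by (intro image_mono sub)+
  ultimately have "cross_intersection_family K m X (\<lambda>i. h ` S i) (\<lambda>j. h ` T j)"
    by (simp add: cross_intersection_family_def card_inter)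
  then show ?thesis
    unfolding S_def T_def .
qed

theorem theorem3:
  fixes K :: "nat set" and k m d :: nat
  assumes "finite K" and "card K = k" and "\<forall>l\<in>K. 0 < l"
    and "0 < m" and "0 < d"
  shows "(\<exists>(X :: 'p::infinite set) A B.
            card X = d \<and> cross_intersection_family K m X A B)
     \<longleftrightarrow> (\<exists>C. biclique_cover_of_type K (crown_graph m) d C)"
proof
  assume "\<exists>(X :: 'p set) A B. card X = d \<and> cross_intersection_family K m X A B"
  then obtain X :: "'p set" and A B
    where X: "card X = d" and family: "cross_intersection_family K m X A B"
    by blast
  have "finite X"
    using family by (simp add: cross_intersection_family_def)
  then obtain h where "bij_betw h {..<d} X"
    using ex_bij_betw_nat_finite X by (metis atLeast0LessThan)
  from biclique_cover_if_cross_intersection_family[OF assms(3) this family]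
  show "\<exists>C. biclique_cover_of_type K (crown_graph m) d C"
    by blast
next
  assume "\<exists>C. biclique_cover_of_type K (crown_graph m) d C"
  then obtain C where cover: "biclique_cover_of_type K (crown_graph m) d C"
    by blast
  obtain X :: "'p set" where X: "finite X" "card X = d"
    using infinite_arbitrarily_large[OF infinite_UNIV] by blast
  then obtain h where "bij_betw h {..<d} X"
    using ex_bij_betw_nat_finite by (metis atLeast0LessThan)
  from cross_intersection_family_if_biclique_cover[OF this cover] X(2)
  show "\<exists>(X :: 'p set) A B. card X = d \<and> cross_intersection_family K m X A B"
    by blast
qed

end
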